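(* On a two-level substrate (level-$0$ capacity $S_0$ bits, fare $c_0$ per bit), let an execution compute exact causal attention over $T$ steps $\kappa$-atomically, with recomputation floor $\gamma_{\mathrm{rc}}$, and let $m=\lceil S_0/\kappa\rceil$. Then $$E\;\ge\;\kappa\,\frac{(T-m)(T-m-1)}{2}\,\min\big(c_0,\gamma_{\mathrm{rc}}\big),$$ independently of the inter-step time: a floor that holds for every scheduling once the context exceeds the fast level ($T>m$).
   Context: Substrate. Storage consists of one-bit cells at a fast level $0$ holding at most $S_0$ bits, with hold power $p_0\ge 0$ (energy per resident bit per unit time), and a slow level $1$; moving a bit across the boundary between them costs $c_0$. Operations fire at stations at level $0$, reading at most two words resident at level $0$ and writing at level $0$. An execution is a finite sequence of steps: holds (time advances; nothing is read, written, created or destroyed), moves (one bit is copied across the boundary into a free cell; the source stays), and fires (one operation; it may free live bits); moves and fires take no time. The energy $E$ is at least the energies of operations, plus $p_0$ times the integral over time of the number of bits resident at level $0$, plus $c_0$ times the number of boundary crossings of bits, dissipated in disjoint physical events. $\kappa$-atomic meetings. An execution computes exact causal attention over $T$ steps $\kappa$-atomically if it keeps representations of its past tokens that are pairwise disjoint as physical bits, of at least $\kappa$ bits each (token $t$'s representation being created at step $t$), and for every pair $t<t'$, step $t'$ performs operations that together read every bit of token $t$'s representation at level $0$; and it recomputes a representation, when it does, only along routes dissipating at least $\gamma_{\mathrm{rc}}$ per bit, meaning: every level-$0$ firing that writes bits of a representation, other than the one creating it, writes bits of no other representation and is either a copy (it reads the same bits of that representation from a level-$0$-resident copy) or belongs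 to a recomputation route; the non-copy firings are partitioned into routes, a route writes bits of one representation, all in its last firing, reads no bit of that representation, and dissipates at least $\gamma_{\mathrm{rc}}$ per bit it writes, counted per write. Steps are time-disjoint: every operation of step $t'$ follows every operation of step $t'-1$. The inter-step time is the least time from the last operation of a step to the first of the next. *)

theory Defs
  imports Complex_Main "HOL-Library.Disjoint_Sets"
begin

text \<open>
  A two-level substrate of one-bit cells.  \<open>Fast\<close> cells form level 0, \<open>Slow\<close> cells level 1.
  A store maps each live cell to the identity (not the truth value) of the bit it holds; a bit may
  be held by several cells at once, and cells outside the domain are free.
\<close>

datatype cell = Fast nat | Slow nat

type_synonym 'b store = "cell \<rightharpoonup> 'b"

definition fast :: "cell set" where
  "fast = range Fast"

text \<open>
  The word layout is left arbitrary: \<open>words\<close> is the family of cell sets that an operation may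
  read as one word.
\<close>

record substrate =
  capacity :: nat
  hold_power :: real
  fare :: real
  words :: "cell set set"

definition cells :: "substrate \<Rightarrow> cell set" where
  "cells S = Fast ` {..<capacity S} \<union> range Slow"

text \<open>
  \<open>Hold d\<close> lets time \<open>d\<close> pass; \<open>Move a b\<close> copies the bit in \<open>a\<close> into \<open>b\<close>;
  \<open>Fire ws fr wr q\<close> is an operation of energy \<open>q\<close> that reads the words \<open>ws\<close>, frees
  the cells \<open>fr\<close> and writes \<open>wr\<close>.
\<close>

datatype 'b event =
    Hold real
  | Move cell cell
  | Fire "cell set set" "cell set" "'b store" real

fun enabled :: "substrate \<Rightarrow> 'b store \<Rightarrow> 'b event \<Rightarrow> bool" where
  "enabled S \<sigma> (Hold d) \<longleftrightarrow> 0 \<le> d"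
| "enabled S \<sigma> (Move a b) \<longleftrightarrow>
     a \<in> dom \<sigma> \<and> b \<in> cells S - dom \<sigma> \<and> (a \<in> fast \<longleftrightarrow> b \<notin> fast)"
| "enabled S \<sigma> (Fire ws fr wr q) \<longleftrightarrow>
     ws \<subseteq> words S \<and> finite ws \<and> card ws \<le> 2 \<and> \<Union>ws \<subseteq> dom \<sigma> \<inter> fast \<and>
     fr \<subseteq> dom \<sigma> \<and> dom wr \<subseteq> cells S \<inter> fast \<and> dom wr \<inter> dom \<sigma> \<subseteq> fr \<and> 0 \<le> q"

fun effect :: "'b event \<Rightarrow> 'b store \<Rightarrow> 'b store" where
  "effect (Hold d) \<sigma> = \<sigma>"
| "effect (Move a b) \<sigma> = \<sigma>(b := \<sigma> a)"
| "effect (Fire ws fr wr q) \<sigma> = (\<sigma> |` (- fr)) ++ wr"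

fun duration :: "'b event \<Rightarrow> real" where
  "duration (Hold d) = d"
| "duration _ = 0"

fun is_move :: "'b event \<Rightarrow> bool" where
  "is_move (Move a b) = True"
| "is_move _ = False"

fun is_fire :: "'b event \<Rightarrow> bool" where
  "is_fire (Fire ws fr wr q) = True"
| "is_fire _ = False"

fun reads :: "'b event \<Rightarrow> cell set" where
  "reads (Fire ws fr wr q) = \<Union>ws"
| "reads _ = {}"

fun writes :: "'b event \<Rightarrow> 'b store" where
  "writes (Fire ws fr wr q) = wr"
| "writes _ = Map.empty"

fun op_energy :: "'b event \<Rightarrow> real" where
  "op_energy (Fire ws fr wr q) = q"
| "op_energy _ = 0"

text \<open>
  Events are referred to by their position in the list.  \<open>step_ops e t\<close> is the set of operations
  of step \<open>t\<close>; an operation may also belong to no step.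
\<close>

record 'b execution =
  init :: "'b store"
  events :: "'b event list"
  step_ops :: "nat \<Rightarrow> nat set"

text \<open>The store just before the event at position \<open>i\<close>.\<close>

definition state :: "'b execution \<Rightarrow> nat \<Rightarrow> 'b store" where
  "state e i = fold effect (take i (events e)) (init e)"

definition valid_execution :: "substrate \<Rightarrow> 'b execution \<Rightarrow> bool" where
  "valid_execution S e \<longleftrightarrow>
     dom (init e) \<subseteq> cells S \<and>
     (\<forall>i < length (events e). enabled S (state e i) (events e ! i))"

definition firings :: "'b execution \<Rightarrow> nat set" where
  "firings e = {i. i < length (events e) \<and> is_fire (events e ! i)}"

definition read_bits :: "'b execution \<Rightarrow> nat \<Rightarrow> 'b set" where
  "read_bits e i = {b. \<exists>c \<in> reads (events e ! i). state e i c = Some b}"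

definition written_bits :: "'b execution \<Rightarrow> nat \<Rightarrow> 'b set" where
  "written_bits e i = ran (writes (events e ! i))"

text \<open>
  Occupancy changes only at events that take no time, so its time integral is a finite sum over
  the holds.
\<close>

definition occupancy_integral :: "'b execution \<Rightarrow> real" where
  "occupancy_integral e =
     (\<Sum>i < length (events e). duration (events e ! i) * real (card (dom (state e i) \<inter> fast)))"

definition crossings :: "'b execution \<Rightarrow> nat" where
  "crossings e = card {i. i < length (events e) \<and> is_move (events e ! i)}"

definition accounted_energy :: "substrate \<Rightarrow> 'b execution \<Rightarrow> real" where
  "accounted_energy S e =
     (\<Sum>i < length (events e). op_energy (events e ! i))
     + hold_power S * occupancy_integral e
     + fare S * real (crossings e)"

definition time_disjoint_steps :: "nat \<Rightarrow> 'b execution \<Rightarrow> bool" where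
  "time_disjoint_steps T e \<longleftrightarrow>
     (\<forall>t \<in> {1..T}. step_ops e t \<subseteq> firings e) \<and>
     (\<forall>t \<in> {1..<T}. \<forall>i \<in> step_ops e t. \<forall>j \<in> step_ops e (Suc t). i < j)"

definition clock :: "'b execution \<Rightarrow> nat \<Rightarrow> real" where
  "clock e i = (\<Sum>j < i. duration (events e ! j))"

definition inter_step_time :: "nat \<Rightarrow> 'b execution \<Rightarrow> real" where
  "inter_step_time T e =
     Min ((\<lambda>t. clock e (Min (step_ops e (Suc t))) - clock e (Max (step_ops e t))) ` {1..<T})"

text \<open>
  \<open>R t\<close> is the set of bits representing token \<open>t\<close>, and \<open>cr t\<close> the firing that creates it.
  As a cell holds one bit, disjoint sets \<open>R t\<close> never share a physical cell.
\<close>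

definition creates :: "'b execution \<Rightarrow> 'b set \<Rightarrow> nat \<Rightarrow> bool" where
  "creates e B i \<longleftrightarrow> B \<subseteq> written_bits e i \<and> (\<forall>j \<le> i. ran (state e j) \<inter> B = {})"

definition keeps_representations ::
    "real \<Rightarrow> nat \<Rightarrow> 'b execution \<Rightarrow> (nat \<Rightarrow> 'b set) \<Rightarrow> (nat \<Rightarrow> nat) \<Rightarrow> bool" where
  "keeps_representations \<kappa> T e R cr \<longleftrightarrow>
     disjoint_family_on R {1..T} \<and>
     (\<forall>t \<in> {1..T}. finite (R t) \<and> \<kappa> \<le> real (card (R t)) \<and>
        cr t \<in> step_ops e t \<and> creates e (R t) (cr t))"

definition meets_past :: "nat \<Rightarrow> 'b execution \<Rightarrow> (nat \<Rightarrow> 'b set) \<Rightarrow> bool" where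
  "meets_past T e R \<longleftrightarrow>
     (\<forall>t' \<in> {1..T}. \<forall>t \<in> {1..<t'}. R t \<subseteq> (\<Union>i \<in> step_ops e t'. read_bits e i))"

definition copies :: "'b execution \<Rightarrow> 'b set \<Rightarrow> nat \<Rightarrow> bool" where
  "copies e B i \<longleftrightarrow>
     written_bits e i \<inter> B \<noteq> {} \<and> written_bits e i \<inter> B \<subseteq> read_bits e i"

text \<open>
  The dissipation of a route is the energy of its own firings.  Its writes are counted by cells,
  so a bit written to two cells counts twice.
\<close>

definition recomputation_route ::
    "real \<Rightarrow> nat \<Rightarrow> 'b execution \<Rightarrow> (nat \<Rightarrow> 'b set) \<Rightarrow> nat set \<Rightarrow> bool" where
  "recomputation_route \<gamma> T e R r \<longleftrightarrow>
     (\<exists>s \<in> {1..T}.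
        written_bits e (Max r) \<inter> R s \<noteq> {} \<and>
        (\<forall>i \<in> r. \<forall>u \<in> {1..T}. written_bits e i \<inter> R u \<noteq> {} \<longrightarrow> u = s \<and> i = Max r) \<and>
        (\<forall>i \<in> r. read_bits e i \<inter> R s = {}) \<and>
        \<gamma> * real (card {c. \<exists>b \<in> R s. writes (events e ! Max r) c = Some b})
          \<le> (\<Sum>i \<in> r. op_energy (events e ! i)))"

text \<open>
  Routes are disjoint sets of non-copy firings.  They may contain auxiliary firings that write no
  representation, and they need to cover only the non-copy firings that rewrite one.
\<close>

definition recomputes_along ::
    "real \<Rightarrow> nat \<Rightarrow> 'b execution \<Rightarrow> (nat \<Rightarrow> 'b set) \<Rightarrow> (nat \<Rightarrow> nat) \<Rightarrow> nat set set \<Rightarrow> bool" where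
  "recomputes_along \<gamma> T e R cr \<R> \<longleftrightarrow>
     (\<forall>t \<in> {1..T}. \<forall>i \<in> firings e - {cr t}. written_bits e i \<inter> R t \<noteq> {} \<longrightarrow>
        (\<forall>s \<in> {1..T} - {t}. written_bits e i \<inter> R s = {}) \<and>
        (copies e (R t) i \<or> i \<in> \<Union>\<R>)) \<and>
     \<Union>\<R> \<subseteq> {i \<in> firings e. \<forall>t \<in> {1..T}. \<not> copies e (R t) i} \<and>
     partition_on (\<Union>\<R>) \<R> \<and>
     (\<forall>r \<in> \<R>. recomputation_route \<gamma> T e R r)"

definition atomic_causal_attention :: "real \<Rightarrow> real \<Rightarrow> nat \<Rightarrow> 'b execution \<Rightarrow> bool" where
  "atomic_causal_attention \<kappa> \<gamma> T e \<longleftrightarrow>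
     time_disjoint_steps T e \<and>
     (\<exists>R cr \<R>. keeps_representations \<kappa> T e R cr \<and> meets_past T e R \<and>
        recomputes_along \<gamma> T e R cr \<R>)"

end

theory Submission
  imports Defs
begin

text \<open>
  Just before step \<open>t'\<close> at most \<open>S\<^sub>0\<close> bits are resident at level 0, whereas the step reads there
  the at least \<open>\<kappa> (t' - 1)\<close> bits of all past representations.  So at least \<open>\<kappa> (t' - 1 - m)\<close> old
  bits become resident while the step is in progress.  A bit that becomes resident cannot come from
  a copy, which would need a resident original, so it is either moved, at the fare, or written by
  the last firing of a recomputation route, at \<open>\<gamma>\<close>.  Different steps occupy disjoint ranges of
  events and different routes are disjoint, so these charges add up over \<open>t' = m + 1, \<dots>, T\<close>.
\<close>

subsection \<open>Bits resident at level 0\<close>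

text \<open>Bits are counted by identity, not by cell: several level-0 holders of one bit count
  once.\<close>

definition fast_bits :: "'b execution \<Rightarrow> nat \<Rightarrow> 'b set" where
  "fast_bits e i = ran (state e i |` fast)"

text \<open>Duplicating a bit that already has a level-0 holder fetches nothing; this keeps copies
  out of the count.\<close>

definition fetched :: "'b execution \<Rightarrow> nat \<Rightarrow> 'b set" where
  "fetched e i = fast_bits e (Suc i) - fast_bits e i"

lemma fast_bits_iff: "b \<in> fast_bits e i \<longleftrightarrow> (\<exists>c\<in>fast. state e i c = Some b)"
  by (auto simp: fast_bits_def ran_def restrict_map_def)

lemma state_Suc:
  "i < length (events e) \<Longrightarrow> state e (Suc i) = effect (events e ! i) (state e i)"
  by (simp add: state_def take_Suc_conv_app_nth)

lemma dom_effect: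
  assumes "enabled S \<sigma> ev" "dom \<sigma> \<subseteq> cells S"
  shows "dom (effect ev \<sigma>) \<subseteq> cells S"
  using assms by (cases ev) auto

lemma dom_state:
  assumes "valid_execution S e" "i \<le> length (events e)"
  shows "dom (state e i) \<subseteq> cells S"
  using assms(2)
proof (induction i)
  case 0
  then show ?case using assms(1) by (simp add: valid_execution_def state_def)
next
  case (Suc i)
  then have "enabled S (state e i) (events e ! i)"
    using assms(1) by (simp add: valid_execution_def)
  with Suc show ?case by (simp add: state_Suc dom_effect)
qed

lemma fast_cells: "cells S \<inter> fast = Fast ` {..<capacity S}"
  by (auto simp: cells_def fast_def)

lemma card_fast_bits:
  assumes "valid_execution S e" "i \<le> length (events e)"
  shows "finite (fast_bits e i)" "card (fast_bits e i) \<le> capacity S"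
proof -
  have sub: "fast_bits e i \<subseteq> (\<lambda>c. the (state e i c)) ` Fast ` {..<capacity S}"
  proof
    fix b assume "b \<in> fast_bits e i"
    then obtain c where c: "c \<in> fast" "state e i c = Some b" by (auto simp: fast_bits_iff)
    then have "c \<in> Fast ` {..<capacity S}"
      using dom_state[OF assms] fast_cells by blast
    with c show "b \<in> (\<lambda>c. the (state e i c)) ` Fast ` {..<capacity S}" by force
  qed
  show "finite (fast_bits e i)" by (rule finite_subset[OF sub]) simp
  have "card (fast_bits e i) \<le> card ((\<lambda>c. the (state e i c)) ` Fast ` {..<capacity S})"
    by (rule card_mono[OF _ sub]) simp
  also have "\<dots> \<le> card (Fast ` {..<capacity S})" by (rule card_image_le) simp
  also have "\<dots> \<le> card {..<capacity S}" by (rule card_image_le) simp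
  finally show "card (fast_bits e i) \<le> capacity S" by simp
qed

text \<open>A discrete intermediate value argument: membership that flips from false to true between
  two positions flips at some single event.\<close>

lemma fetched_between:
  assumes "k \<le> j" "b \<notin> fast_bits e k" "b \<in> fast_bits e j"
  obtains i where "k \<le> i" "i < j" "b \<in> fetched e i"
proof -
  have "\<exists>i. k \<le> i \<and> i < j \<and> b \<in> fetched e i"
    using assms
  proof (induction j rule: dec_induct)
    case (step n)
    then show ?case by (cases "b \<in> fast_bits e n") (auto simp: fetched_def less_Suc_eq)
  qed simp
  then show thesis using that by blast
qed

lemma read_bits_resident:
  assumes "valid_execution S e" "i < length (events e)"
  shows "read_bits e i \<subseteq> fast_bits e i"
proof -
  have "enabled S (state e i) (events e ! i)"
    using assms by (simp add: valid_execution_def)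
  then have "reads (events e ! i) \<subseteq> fast" by (cases "events e ! i") auto
  then show ?thesis by (simp add: read_bits_def fast_bits_iff subset_iff) blast
qed

text \<open>A move changes only its destination cell, so the only candidate is the bit held by the
  source.\<close>

lemma fetched_move:
  assumes "i < length (events e)" "events e ! i = Move a c"
  shows "card (fetched e i) \<le> 1"
proof -
  have "fetched e i \<subseteq> {the (state e i a)}"
    using assms by (auto simp: fetched_def fast_bits_iff state_Suc split: if_splits)
  then show ?thesis using card_mono[of "{the (state e i a)}" "fetched e i"] by simp
qed

lemma fetched_fire:
  assumes "i < length (events e)" "is_fire (events e ! i)"
  shows "fetched e i \<subseteq> written_bits e i"
proof (cases "events e ! i")
  case (Fire ws fr wr q)
  show ?thesis
  proof
    fix b assume b: "b \<in> fetched e i"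
    then obtain c where "c \<in> fast" "state e (Suc i) c = Some b"
      by (auto simp: fetched_def fast_bits_iff)
    then have c: "c \<in> fast" "((state e i |` (- fr)) ++ wr) c = Some b"
      using assms(1) Fire by (auto simp: state_Suc)
    have "state e i c \<noteq> Some b" using b c(1) by (auto simp: fetched_def fast_bits_iff)
    with c(2) have "wr c = Some b"
      by (auto simp: map_add_Some_iff restrict_map_def split: if_splits)
    then show "b \<in> written_bits e i" using Fire by (auto simp: written_bits_def ran_def)
  qed
qed (use assms in auto)

lemma fetched_hold:
  "i < length (events e) \<Longrightarrow> events e ! i = Hold d \<Longrightarrow> fetched e i = {}"
  by (simp add: fetched_def fast_bits_def state_Suc)

subsection \<open>The price of a fetched bit\<close>

text \<open>Only entries that must be paid for are kept: bits of no representation may be written at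
  no price, and the creating firing is subject to neither the copy nor the route condition.\<close>

definition refetched ::
    "nat \<Rightarrow> 'b execution \<Rightarrow> (nat \<Rightarrow> 'b set) \<Rightarrow> (nat \<Rightarrow> nat) \<Rightarrow> nat \<Rightarrow> 'b set" where
  "refetched T e R cr i = {b \<in> fetched e i. \<exists>t\<in>{1..T}. b \<in> R t \<and> i \<noteq> cr t}"

lemma refetched_subset: "refetched T e R cr i \<subseteq> fetched e i"
  by (auto simp: refetched_def)

lemma finite_refetched:
  assumes "valid_execution S e" "i < length (events e)"
  shows "finite (refetched T e R cr i)"
proof (rule finite_subset)
  show "refetched T e R cr i \<subseteq> fast_bits e (Suc i)"
    by (auto simp: refetched_def fetched_def)
  show "finite (fast_bits e (Suc i))"
    using card_fast_bits(1)[OF assms(1)] assms(2) by simp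
qed

lemma op_energy_nonneg:
  assumes "valid_execution S e" "i < length (events e)"
  shows "0 \<le> op_energy (events e ! i)"
proof -
  have "enabled S (state e i) (events e ! i)"
    using assms by (simp add: valid_execution_def)
  then show ?thesis by (cases "events e ! i") auto
qed

lemma duration_nonneg:
  assumes "valid_execution S e" "i < length (events e)"
  shows "0 \<le> duration (events e ! i)"
proof -
  have "enabled S (state e i) (events e ! i)"
    using assms by (simp add: valid_execution_def)
  then show ?thesis by (cases "events e ! i") auto
qed

lemma occupancy_integral_nonneg:
  "valid_execution S e \<Longrightarrow> 0 \<le> occupancy_integral e"
  unfolding occupancy_integral_def
  by (intro sum_nonneg mult_nonneg_nonneg) (auto simp: duration_nonneg)

text \<open>A firing reads only resident bits, and a fetched bit was not resident, so the firing is
  no copy and must lie on a route.\<close>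

lemma refetched_fire_route:
  assumes val: "valid_execution S e"
    and rec: "recomputes_along \<gamma> T e R cr \<R>"
    and i: "i < length (events e)" "is_fire (events e ! i)"
    and ne: "refetched T e R cr i \<noteq> {}"
    and \<gamma>: "0 \<le> \<gamma>"
  obtains r where "r \<in> \<R>" "i = Max r"
    "\<gamma> * real (card (refetched T e R cr i)) \<le> (\<Sum>j\<in>r. op_energy (events e ! j))"
proof -
  let ?G = "refetched T e R cr i"
  have GW: "?G \<subseteq> written_bits e i"
    using refetched_subset[of T e R cr i] fetched_fire[OF i] by blast
  obtain b t where b: "b \<in> ?G" "t \<in> {1..T}" "b \<in> R t" "i \<noteq> cr t"
    using ne unfolding refetched_def by blast
  have W: "written_bits e i \<inter> R t \<noteq> {}" using b GW by blast
  have "i \<in> firings e - {cr t}" using i b by (simp add: firings_def)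
  with rec b W have "copies e (R t) i \<or> i \<in> \<Union>\<R>"
    unfolding recomputes_along_def by blast
  moreover have "\<not> copies e (R t) i"
  proof
    assume "copies e (R t) i"
    then have "b \<in> read_bits e i" using b GW by (auto simp: copies_def)
    then have "b \<in> fast_bits e i" using read_bits_resident[OF val i(1)] by blast
    then show False using b(1) by (auto simp: refetched_def fetched_def)
  qed
  ultimately obtain r where r: "r \<in> \<R>" "i \<in> r" by blast
  then have "recomputation_route \<gamma> T e R r" using rec by (simp add: recomputes_along_def)
  then obtain s where s: "s \<in> {1..T}"
      "\<And>j u. j \<in> r \<Longrightarrow> u \<in> {1..T} \<Longrightarrow> written_bits e j \<inter> R u \<noteq> {} \<Longrightarrow> u = s \<and> j = Max r"
      "\<gamma> * real (card {c. \<exists>b \<in> R s. writes (events e ! Max r) c = Some b})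
          \<le> (\<Sum>j \<in> r. op_energy (events e ! j))"
    unfolding recomputation_route_def by blast
  \<comment> \<open>A route writes representation bits only in its last firing. This later makes the
    assignment of routes to firings injective.\<close>
  have iM: "i = Max r" using s(2) r b W by blast
  let ?C = "{c. \<exists>b \<in> R s. writes (events e ! i) c = Some b}"
  \<comment> \<open>The route is priced per written cell, while \<open>?G\<close> counts bits.
    Sending each cell to its bit covers \<open>?G\<close>, since the firing writes no representation
    other than \<open>R s\<close>.\<close>
  have "?G \<subseteq> (\<lambda>c. the (writes (events e ! i) c)) ` ?C"
  proof
    fix x assume x: "x \<in> ?G"
    then obtain u where u: "u \<in> {1..T}" "x \<in> R u" by (auto simp: refetched_def)
    with s(2)[OF r(2)] x GW have "x \<in> R s" by blast
    moreover obtain c where "writes (events e ! i) c = Some x"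
      using x GW by (auto simp: written_bits_def ran_def)
    ultimately show "x \<in> (\<lambda>c. the (writes (events e ! i) c)) ` ?C" by force
  qed
  \<comment> \<open>An infinite \<open>?C\<close> would have \<open>card\<close> 0 and make the
    price vacuous; writes go to the finitely many level-0 cells.\<close>
  moreover have "finite ?C"
  proof (rule finite_subset)
    have "enabled S (state e i) (events e ! i)"
      using val i by (simp add: valid_execution_def)
    then show "?C \<subseteq> Fast ` {..<capacity S}"
      unfolding fast_cells[symmetric] by (cases "events e ! i") auto
  qed simp
  ultimately have "card ?G \<le> card ?C" by (rule surj_card_le[rotated])
  then have "\<gamma> * real (card ?G) \<le> \<gamma> * real (card ?C)"
    using \<gamma> by (intro mult_left_mono) auto
  also have "\<dots> \<le> (\<Sum>j\<in>r. op_energy (events e ! j))" using s(3) iM by simp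
  finally show thesis using that r iM by blast
qed

text \<open>The charges fall on separate terms of the energy: moves on the fares, firings on the
  operation energies of their routes.\<close>

lemma refetched_cost:
  assumes val: "valid_execution S e"
    and rec: "recomputes_along \<gamma> T e R cr \<R>"
    and "0 \<le> hold_power S" and \<mu>: "0 \<le> \<mu>" "\<mu> \<le> fare S" "\<mu> \<le> \<gamma>"
  shows "\<mu> * real (\<Sum>i<length (events e). card (refetched T e R cr i)) \<le> accounted_energy S e"
proof -
  let ?n = "length (events e)"
  let ?g = "\<lambda>i. card (refetched T e R cr i)"
  let ?q = "\<lambda>i. op_energy (events e ! i)"
  define M where "M = {i. i < ?n \<and> is_move (events e ! i)}"
  \<comment> \<open>Firings that refetch nothing are left out, as they need not lie on any
    route.\<close>
  define F where "F = {i. i < ?n \<and> is_fire (events e ! i) \<and> refetched T e R cr i \<noteq> {}}"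
  have [simp]: "finite M" "finite F" by (auto simp: M_def F_def)
  have zero: "?g i = 0" if "i \<in> {..<?n} - (M \<union> F)" for i
    using that fetched_hold[of i e] refetched_subset[of T e R cr i]
    by (cases "events e ! i") (auto simp: M_def F_def)
  have split: "(\<Sum>i<?n. ?g i) = sum ?g M + sum ?g F"
  proof -
    have "(\<Sum>i<?n. ?g i) = sum ?g (M \<union> F)"
      by (rule sum.mono_neutral_right) (use zero in \<open>auto simp: M_def F_def\<close>)
    also have "\<dots> = sum ?g M + sum ?g F"
    proof (rule sum.union_disjoint)
      have "\<not> (is_move ev \<and> is_fire ev)" for ev :: "'a event" by (cases ev) auto
      then show "M \<inter> F = {}" by (auto simp: M_def F_def)
    qed auto
    finally show ?thesis .
  qed
  have "?g i \<le> 1" if "i \<in> M" for i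
  proof -
    from that obtain a c where "i < ?n" "events e ! i = Move a c"
      by (cases "events e ! i") (auto simp: M_def)
    note mv = this
    have "finite (fetched e i)"
      using card_fast_bits(1)[OF val, of "Suc i"] mv(1) by (simp add: fetched_def)
    then have "?g i \<le> card (fetched e i)" by (rule card_mono) (rule refetched_subset)
    with fetched_move[OF mv] show ?thesis by simp
  qed
  then have "sum ?g M \<le> crossings e"
    using sum_mono[of M ?g "\<lambda>_. 1"] by (simp add: crossings_def M_def)
  then have moves: "\<mu> * real (sum ?g M) \<le> fare S * real (crossings e)"
    using \<mu> by (intro mult_mono) (auto simp del: of_nat_sum)

  have "\<exists>r\<in>\<R>. i = Max r \<and> \<gamma> * real (?g i) \<le> sum ?q r" if "i \<in> F" for i
    using refetched_fire_route[OF val rec, of i] that \<mu> by (auto simp: F_def)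
  then obtain rt where rt: "\<And>i. i \<in> F \<Longrightarrow> rt i \<in> \<R>" "\<And>i. i \<in> F \<Longrightarrow> i = Max (rt i)"
      "\<And>i. i \<in> F \<Longrightarrow> \<gamma> * real (?g i) \<le> sum ?q (rt i)"
    by metis
  have part: "disjoint \<R>" and sub: "\<Union>\<R> \<subseteq> {..<?n}"
    using rec by (auto simp: recomputes_along_def partition_on_def firings_def)
  \<comment> \<open>Distinct firings are the maxima of distinct routes, and distinct blocks of the
    partition are disjoint, so no energy is charged twice.\<close>
  have disj: "rt i \<inter> rt j = {}" if "i \<in> F" "j \<in> F" "i \<noteq> j" for i j
    using that rt(1,2) part by (metis disjointD)
  have fin: "finite (rt i)" if "i \<in> F" for i
    using rt(1)[OF that] sub by (meson Sup_upper finite_lessThan finite_subset)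
  have "\<mu> * real (sum ?g F) = (\<Sum>i\<in>F. \<mu> * real (?g i))"
    by (simp add: sum_distrib_left)
  also have "\<dots> \<le> (\<Sum>i\<in>F. sum ?q (rt i))"
  proof (rule sum_mono)
    fix i assume "i \<in> F"
    have "\<mu> * real (?g i) \<le> \<gamma> * real (?g i)" using \<mu> by (intro mult_right_mono) auto
    also have "\<dots> \<le> sum ?q (rt i)" by (rule rt(3)) fact
    finally show "\<mu> * real (?g i) \<le> sum ?q (rt i)" .
  qed
  also have "\<dots> = sum ?q (\<Union>i\<in>F. rt i)"
    by (rule sum.UNION_disjoint[symmetric]) (use disj fin in auto)
  also have "\<dots> \<le> sum ?q {..<?n}"
    by (rule sum_mono2) (use rt(1) sub op_energy_nonneg[OF val] in auto)
  finally have fires: "\<mu> * real (sum ?g F) \<le> sum ?q {..<?n}" .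
  \<comment> \<open>Time enters the energy only here. Bounding this term below by 0 makes the floor
    hold for every schedule.\<close>
  have "0 \<le> hold_power S * occupancy_integral e"
    using assms(3) occupancy_integral_nonneg[OF val] by simp
  with moves fires show ?thesis
    by (simp add: split accounted_energy_def algebra_simps del: of_nat_sum)
qed

text \<open>Settles the case of a negative \<gamma>, where the claimed floor is at most 0.\<close>

lemma accounted_energy_nonneg:
  assumes "valid_execution S e" "0 \<le> hold_power S" "0 \<le> fare S"
  shows "0 \<le> accounted_energy S e"
  unfolding accounted_energy_def
  using assms op_energy_nonneg[OF assms(1)] occupancy_integral_nonneg[OF assms(1)]
  by (intro add_nonneg_nonneg sum_nonneg mult_nonneg_nonneg) auto

subsection \<open>Counting the fetches\<close>

text \<open>Only consecutive steps are ordered by definition. Chaining the order needs an operation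
  in every step between, hence the nonemptiness assumption.\<close>

lemma step_ops_ordered:
  assumes td: "time_disjoint_steps T e"
    and ne: "\<And>t. t \<in> {1..T} \<Longrightarrow> step_ops e t \<noteq> {}"
    and "1 \<le> t" "t < t'" "t' \<le> T" "i \<in> step_ops e t" "j \<in> step_ops e t'"
  shows "i < j"
  using assms(4,5,7)
proof (induction t' arbitrary: j)
  case (Suc u)
  have succ: "i < j" if "s \<in> {1..<T}" "i \<in> step_ops e s" "j \<in> step_ops e (Suc s)" for s i j
    using td that by (simp add: time_disjoint_steps_def)
  show ?case
  proof (cases "u = t")
    case True
    then show ?thesis
      using succ[of t] Suc.prems assms(3,6) by simp
  next
    case False
    with Suc.prems have u: "t < u" "u \<le> T" by auto
    then obtain k where k: "k \<in> step_ops e u" using ne[of u] assms(3) by fastforce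
    then have "i < k" using Suc.IH u by blast
    also have "k < j"
      using succ[of u] k Suc.prems assms(3) by simp
    finally show ?thesis .
  qed
qed simp

text \<open>
  The last operation of the step is left out: the bits it reads are resident before it fires.
\<close>

definition window :: "'b execution \<Rightarrow> nat \<Rightarrow> nat set" where
  "window e t = {i. (LEAST k. k \<in> step_ops e t) \<le> i \<and> (\<exists>j\<in>step_ops e t. i < j)}"

text \<open>The bit is absent at the first operation of the step and resident when read at
  \<open>i\<close>, so it enters strictly before \<open>i\<close>, even if \<open>i\<close> is the
  last operation.\<close>

lemma fetched_in_window:
  assumes val: "valid_execution S e"
    and ops: "step_ops e t \<subseteq> firings e" "i \<in> step_ops e t"
    and b: "b \<in> read_bits e i" "b \<notin> fast_bits e (LEAST k. k \<in> step_ops e t)"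
  obtains k where "k \<in> window e t" "b \<in> fetched e k"
proof -
  have "i < length (events e)" using ops by (auto simp: firings_def)
  then have "b \<in> fast_bits e i" using read_bits_resident[OF val] b by blast
  moreover have "(LEAST k. k \<in> step_ops e t) \<le> i" using ops(2) by (rule Least_le)
  ultimately obtain k where "(LEAST k. k \<in> step_ops e t) \<le> k" "k < i" "b \<in> fetched e k"
    using b(2) fetched_between by metis
  then show thesis using that ops(2) by (auto simp: window_def)
qed

text \<open>Each position in the earlier window lies before some operation of its step, and all of
  these precede the position where the later window starts.\<close>

lemma window_disjoint:
  assumes td: "time_disjoint_steps T e"
    and ne: "\<And>t. t \<in> {1..T} \<Longrightarrow> step_ops e t \<noteq> {}"
    and "1 \<le> t" "t < t'" "t' \<le> T"
  shows "window e t \<inter> window e t' = {}"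
proof -
  obtain k where "k \<in> step_ops e t'" using ne[of t'] assms(3-5) by fastforce
  then have "(LEAST k. k \<in> step_ops e t') \<in> step_ops e t'" by (rule LeastI)
  then have "j < (LEAST k. k \<in> step_ops e t')" if "j \<in> step_ops e t" for j
    using step_ops_ordered[OF assms that] by blast
  then show ?thesis by (force simp: window_def)
qed

text \<open>The disjoint past representations hold at least \<kappa> (t' - 1) bits, of which at most
  the capacity can be resident when the step starts.\<close>

lemma refetched_in_step:
  assumes val: "valid_execution S e"
    and td: "time_disjoint_steps T e"
    and keeps: "keeps_representations \<kappa> T e R cr"
    and meets: "meets_past T e R"
    and t': "t' \<in> {1..T}"
  shows "\<kappa> * real (t' - 1) - real (capacity S)
      \<le> real (\<Sum>i\<in>window e t'. card (refetched T e R cr i))"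
proof -
  let ?lo = "LEAST k. k \<in> step_ops e t'"
  let ?P = "\<Union>t\<in>{1..<t'}. R t"
  have cr: "cr t \<in> step_ops e t" and fin: "finite (R t)" and big: "\<kappa> \<le> real (card (R t))"
    if "t \<in> {1..T}" for t
    using keeps that by (auto simp: keeps_representations_def)
  have ne: "step_ops e t \<noteq> {}" if "t \<in> {1..T}" for t using cr[OF that] by blast
  have fire: "step_ops e t' \<subseteq> firings e" using td t' by (auto simp: time_disjoint_steps_def)
  have lo: "?lo \<in> step_ops e t'" using cr[OF t'] by (rule LeastI)
  then have "?lo \<le> length (events e)" using fire by (auto simp: firings_def)
  note resident = card_fast_bits[OF val this]
  have finw: "finite (window e t')"
    by (rule finite_subset[of _ "{..<length (events e)}"])
      (use fire in \<open>auto simp: window_def firings_def\<close>)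
  have win: "i < length (events e)" if "i \<in> window e t'" for i
    using that fire by (auto simp: window_def firings_def)
  have sub: "?P - fast_bits e ?lo \<subseteq> (\<Union>i\<in>window e t'. refetched T e R cr i)"
  proof
    fix b assume b: "b \<in> ?P - fast_bits e ?lo"
    then obtain t where t: "t \<in> {1..<t'}" "b \<in> R t" by blast
    then obtain i where "i \<in> step_ops e t'" "b \<in> read_bits e i"
      using meets t' unfolding meets_past_def by blast
    then obtain k where k: "k \<in> window e t'" "b \<in> fetched e k"
      using fetched_in_window[OF val fire] b by blast
    \<comment> \<open>The token was created in an earlier step, so the fetch inside this window is
      not its creation.\<close>
    have "cr t < ?lo"
      using step_ops_ordered[OF td ne _ _ _ cr lo] t t' by auto
    also have "?lo \<le> k" using k by (simp add: window_def)
    finally have "b \<in> refetched T e R cr k"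
      using k(2) t t' by (auto simp: refetched_def)
    with k(1) show "b \<in> (\<Union>i\<in>window e t'. refetched T e R cr i)" by blast
  qed
  have "\<kappa> * real (t' - 1) \<le> (\<Sum>t\<in>{1..<t'}. real (card (R t)))"
    using sum_mono[of "{1..<t'}" "\<lambda>_. \<kappa>" "\<lambda>t. real (card (R t))"] big t'
    by (simp add: mult.commute)
  also have "\<dots> = real (card ?P)"
  proof -
    have "card ?P = (\<Sum>t\<in>{1..<t'}. card (R t))"
    proof (rule card_UN_disjoint)
      show "\<forall>t\<in>{1..<t'}. finite (R t)" using fin t' by auto
      show "\<forall>i\<in>{1..<t'}. \<forall>j\<in>{1..<t'}. i \<noteq> j \<longrightarrow> R i \<inter> R j = {}"
        using keeps t' by (auto simp: keeps_representations_def disjoint_family_on_def)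
    qed simp
    then show ?thesis by simp
  qed
  also have "\<dots> \<le> real (card (?P - fast_bits e ?lo)) + real (capacity S)"
    using diff_card_le_card_Diff[OF resident(1), of ?P] resident(2) by linarith
  also have "card (?P - fast_bits e ?lo) \<le> card (\<Union>i\<in>window e t'. refetched T e R cr i)"
    by (rule card_mono[OF _ sub]) (use finw win finite_refetched[OF val] in auto)
  also have "\<dots> \<le> (\<Sum>i\<in>window e t'. card (refetched T e R cr i))"
    by (rule card_UN_le[OF finw])
  finally show ?thesis by simp
qed

text \<open>Step M + k + 1 has M + k past tokens. M of them absorb the capacity, leaving at least
  \<kappa> k bits to refetch; summing over k < T - M gives the triangular number.\<close>

lemma refetched_total:
  assumes val: "valid_execution S e"
    and td: "time_disjoint_steps T e"
    and keeps: "keeps_representations \<kappa> T e R cr"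
    and meets: "meets_past T e R"
    and M: "real (capacity S) \<le> \<kappa> * real M" "M \<le> T"
  shows "\<kappa> * (real (T - M) * (real (T - M) - 1) / 2)
      \<le> real (\<Sum>i<length (events e). card (refetched T e R cr i))"
proof -
  let ?g = "\<lambda>i. card (refetched T e R cr i)"
  have ne: "step_ops e t \<noteq> {}" if "t \<in> {1..T}" for t
    using keeps that by (auto simp: keeps_representations_def)
  have win: "window e t \<subseteq> {..<length (events e)}" if "t \<in> {1..T}" for t
  proof -
    have "step_ops e t \<subseteq> firings e" using td that by (auto simp: time_disjoint_steps_def)
    then show ?thesis by (auto simp: window_def firings_def)
  qed
  have gauss: "(\<Sum>k<n. real k) = real n * (real n - 1) / 2" for n
    by (induction n) (auto simp: field_simps)
  have "\<kappa> * (real (T - M) * (real (T - M) - 1) / 2) = (\<Sum>k<T - M. \<kappa> * real k)"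
    by (simp add: gauss flip: sum_distrib_left)
  also have "\<dots> \<le> (\<Sum>k<T - M. real (sum ?g (window e (Suc (M + k)))))"
  proof (rule sum_mono)
    fix k assume "k \<in> {..<T - M}"
    then have "Suc (M + k) \<in> {1..T}" using M(2) by auto
    from refetched_in_step[OF val td keeps meets this]
    show "\<kappa> * real k \<le> real (sum ?g (window e (Suc (M + k))))"
      using M(1) by (simp add: algebra_simps)
  qed
  also have "\<dots> = real (\<Sum>k<T - M. sum ?g (window e (Suc (M + k))))" by simp
  also have "(\<Sum>k<T - M. sum ?g (window e (Suc (M + k))))
      = sum ?g (\<Union>k<T - M. window e (Suc (M + k)))"
  proof (rule sum.UNION_disjoint[symmetric])
    show "\<forall>k\<in>{..<T - M}. finite (window e (Suc (M + k)))"
      using finite_subset[OF win] by auto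
    show "\<forall>i\<in>{..<T - M}. \<forall>j\<in>{..<T - M}. i \<noteq> j \<longrightarrow>
        window e (Suc (M + i)) \<inter> window e (Suc (M + j)) = {}"
    proof (intro ballI impI)
      fix i j assume ij: "i \<in> {..<T - M}" "j \<in> {..<T - M}" "i \<noteq> j"
      then consider "i < j" | "j < i" by linarith
      then show "window e (Suc (M + i)) \<inter> window e (Suc (M + j)) = {}"
      proof cases
        case 1
        then show ?thesis by (intro window_disjoint[OF td ne]) (use ij in auto)
      next
        case 2
        then have "window e (Suc (M + j)) \<inter> window e (Suc (M + i)) = {}"
          by (intro window_disjoint[OF td ne]) (use ij in auto)
        then show ?thesis by blast
      qed
    qed
  qed simp
  also have "\<dots> \<le> sum ?g {..<length (events e)}"
  proof (rule sum_mono2)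
    have "window e (Suc (M + k)) \<subseteq> {..<length (events e)}" if "k < T - M" for k
      by (rule win) (use that in auto)
    then show "(\<Union>k<T - M. window e (Suc (M + k))) \<subseteq> {..<length (events e)}" by blast
  qed auto
  finally show ?thesis by simp
qed

section \<open>The energy floor from the number of refetches and their price\<close>

theorem corollary3:
  fixes S :: substrate and e :: "'b execution" and T :: nat and m :: int
    and \<kappa> \<gamma>\<^sub>r\<^sub>c E \<tau> :: real
  assumes "0 \<le> hold_power S" and "0 \<le> fare S" and "0 < \<kappa>"
    and "valid_execution S e"
    and "atomic_causal_attention \<kappa> \<gamma>\<^sub>r\<^sub>c T e"
    and "accounted_energy S e \<le> E"
    and "inter_step_time T e = \<tau>"
    and "m = \<lceil>real (capacity S) / \<kappa>\<rceil>"
    and "m < int T"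
  shows "E \<ge> \<kappa> * ((real T - real_of_int m) * (real T - real_of_int m - 1) / 2)
               * min (fare S) \<gamma>\<^sub>r\<^sub>c"
proof -
  let ?\<mu> = "min (fare S) \<gamma>\<^sub>r\<^sub>c"
  let ?N = "(real T - real_of_int m) * (real T - real_of_int m - 1) / 2"
  obtain R cr \<R> where att: "time_disjoint_steps T e" "keeps_representations \<kappa> T e R cr"
      "meets_past T e R" "recomputes_along \<gamma>\<^sub>r\<^sub>c T e R cr \<R>"
    using assms(5) by (auto simp: atomic_causal_attention_def)
  define M where "M = nat m"
  have "0 \<le> real (capacity S) / \<kappa>" using assms(3) by simp
  \<comment> \<open>Nonnegativity makes \<open>nat m\<close> faithful, so m can serve as a number of
    steps.\<close>
  then have m0: "0 \<le> m" using assms(8) by (simp add: ceiling_mono[of 0, simplified])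
  have M: "real_of_int m = real M" "M < T" using m0 assms(9) by (auto simp: M_def)
  have "real (capacity S) / \<kappa> \<le> real M" using assms(8) M(1) by (metis le_of_int_ceiling)
  then have cap: "real (capacity S) \<le> \<kappa> * real M" using assms(3) by (simp add: field_simps)
  have N: "?N = real (T - M) * (real (T - M) - 1) / 2" using M by (simp add: of_nat_diff)
  \<comment> \<open>With T - M at least 1, both factors of \<open>?N\<close> are
    nonnegative.\<close>
  have "1 \<le> real (T - M)" using M(2) by simp
  then have pos: "0 \<le> \<kappa> * ?N" using assms(3) unfolding N by simp
  have "\<kappa> * ?N * ?\<mu> \<le> accounted_energy S e"
  \<comment> \<open>The recomputation floor may be negative, and multiplying the count by
    \<open>?\<mu>\<close> preserves the inequality only for \<open>?\<mu>\<close> \<ge> 0.\<close>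
  proof (cases "0 \<le> ?\<mu>")
    case True
    have "\<kappa> * ?N * ?\<mu>
        \<le> real (\<Sum>i<length (events e). card (refetched T e R cr i)) * ?\<mu>"
      unfolding N using refetched_total[OF assms(4) att(1-3) cap] M(2) True
      by (intro mult_right_mono) auto
    also have "\<dots> \<le> accounted_energy S e"
      using refetched_cost[OF assms(4) att(4) assms(1) True] by (simp add: mult.commute)
    finally show ?thesis .
  next
    case False
    then have "\<kappa> * ?N * ?\<mu> \<le> 0" using pos by (intro mult_nonneg_nonpos) auto
    with accounted_energy_nonneg[OF assms(4,1,2)] show ?thesis by linarith
  qed
  with assms(6) show ?thesis by linarith
qed

end
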